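(* Let $(X,\tau,T)$ be an operator topological space and $(Y,\delta)$ a topological space. If $f:(X,\tau,T)\to(Y,\delta)$ is an almost $T^*$-continuous function, then $f$ is weakly almost contra-$T^*$-continuous.
   Context: $P(X)$ is the power set of $X$; $\mathrm{Cl}$ and $\mathrm{Int}$ denote closure and interior. A set $A$ is regular open if $A=\mathrm{Int}(\mathrm{Cl}(A))$ and regular closed if $A=\mathrm{Cl}(\mathrm{Int}(A))$. An operator topological space $(X,\tau,T)$ is a topological space $(X,\tau)$ with a function $T:P(X)\to P(X)$ such that $U\subseteq T(U)$ for all $U\in\tau$. A set $A\subseteq X$ (not necessarily open) is $T^*$-open if $A\subseteq T(A)$, and $T^*$-closed if its complement is $T^*$-open. $T^*\mathrm{Cl}(A)$ is the intersection of all $T^*$-closed sets containing $A$. A function $f:(X,\tau,T)\to(Y,\delta)$ is almost $T^*$-continuous if $f^{-1}(V)$ is $T^*$-open in $X$ for every regular open $V\subseteq Y$. It is weakly almost contra-$T^*$-continuous if for every regular open $V\subseteq Y$ and every regular closed $S\subseteq Y$ with $S\subseteq V$, one has $T^*\mathrm{Cl}(f^{-1}(S))\subseteq f^{-1}(V)$. *)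

theory Defs
  imports "HOL-Analysis.Abstract_Topology"
begin

definition regular_open_in :: "'a topology \<Rightarrow> 'a set \<Rightarrow> bool" where
  "regular_open_in X A \<longleftrightarrow> A = X interior_of (X closure_of A)"

definition regular_closed_in :: "'a topology \<Rightarrow> 'a set \<Rightarrow> bool" where
  "regular_closed_in X A \<longleftrightarrow> A = X closure_of (X interior_of A)"

(* The values of T outside Pow (topspace X) are irrelevant junk: the definitions below
   only ever apply T to subsets of topspace X. *)
definition operator_topological_space :: "'a topology \<Rightarrow> ('a set \<Rightarrow> 'a set) \<Rightarrow> bool" where
  "operator_topological_space X T \<longleftrightarrow>
     T \<in> Pow (topspace X) \<rightarrow> Pow (topspace X) \<and> (\<forall>U. openin X U \<longrightarrow> U \<subseteq> T U)"

definition Tstar_open :: "'a topology \<Rightarrow> ('a set \<Rightarrow> 'a set) \<Rightarrow> 'a set \<Rightarrow> bool" where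
  "Tstar_open X T A \<longleftrightarrow> A \<subseteq> topspace X \<and> A \<subseteq> T A"

definition Tstar_closed :: "'a topology \<Rightarrow> ('a set \<Rightarrow> 'a set) \<Rightarrow> 'a set \<Rightarrow> bool" where
  "Tstar_closed X T A \<longleftrightarrow> A \<subseteq> topspace X \<and> Tstar_open X T (topspace X - A)"

(* For A a subset of topspace X the intersected family is nonempty, since topspace X
   itself is T*-closed. *)
definition Tstar_closure :: "'a topology \<Rightarrow> ('a set \<Rightarrow> 'a set) \<Rightarrow> 'a set \<Rightarrow> 'a set" where
  "Tstar_closure X T A = \<Inter>{C. Tstar_closed X T C \<and> A \<subseteq> C}"

(* The preimage of V under f : X -> Y is {x \<in> topspace X. f x \<in> V}. That f maps
   topspace X into topspace Y is not part of the two notions below; it is a separate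
   assumption wherever they are used. *)
definition almost_Tstar_continuous ::
    "'a topology \<Rightarrow> ('a set \<Rightarrow> 'a set) \<Rightarrow> 'b topology \<Rightarrow> ('a \<Rightarrow> 'b) \<Rightarrow> bool" where
  "almost_Tstar_continuous X T Y f \<longleftrightarrow>
     (\<forall>V. regular_open_in Y V \<longrightarrow> Tstar_open X T {x \<in> topspace X. f x \<in> V})"

definition weakly_almost_contra_Tstar_continuous ::
    "'a topology \<Rightarrow> ('a set \<Rightarrow> 'a set) \<Rightarrow> 'b topology \<Rightarrow> ('a \<Rightarrow> 'b) \<Rightarrow> bool" where
  "weakly_almost_contra_Tstar_continuous X T Y f \<longleftrightarrow>
     (\<forall>V S. regular_open_in Y V \<longrightarrow> regular_closed_in Y S \<longrightarrow> S \<subseteq> V \<longrightarrow>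
        Tstar_closure X T {x \<in> topspace X. f x \<in> S} \<subseteq> {x \<in> topspace X. f x \<in> V})"

end

theory Submission
  imports Defs
begin

(* The complement of a regular closed set is regular open, so preimages of regular closed
   sets under f are T*-closed and hence coincide with their T*-closure. *)

text \<open>Taking preimages commutes with complements, so almost T*-continuity, applied to the
  regular open complement of S, makes the preimage of S T*-closed
  (\<open>Tstar_closed_vimage\<close>). By \<open>Tstar_closure_eq\<close> its T*-closure adds no
  points, and S \<subseteq> V finishes.\<close>

lemma regular_open_in_complement:
  assumes "regular_closed_in Y S"
  shows "regular_open_in Y (topspace Y - S)"
  using assms unfolding regular_open_in_def regular_closed_in_def
  by (simp add: closure_of_complement interior_of_complement)

text \<open>\<open>A\<close> is itself the least member of the intersected family.\<close>

lemma Tstar_closure_eq: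
  assumes "Tstar_closed X T A"
  shows "Tstar_closure X T A = A"
  using assms unfolding Tstar_closure_def by blast

lemma Tstar_closed_vimage:
  assumes "f \<in> topspace X \<rightarrow> topspace Y"
    and "almost_Tstar_continuous X T Y f"
    and "regular_closed_in Y S"
  shows "Tstar_closed X T {x \<in> topspace X. f x \<in> S}"
proof -
  \<comment> \<open>A point whose image misses \<open>S\<close> lands in
    \<open>topspace Y - S\<close> because \<open>f\<close> maps into
    \<open>topspace Y\<close>.\<close>
  have "topspace X - {x \<in> topspace X. f x \<in> S} = {x \<in> topspace X. f x \<in> topspace Y - S}"
    using assms(1) by auto
  then show ?thesis
    using assms(2) regular_open_in_complement[OF assms(3)]
    unfolding Tstar_closed_def almost_Tstar_continuous_def by auto
qed

theorem proposition2:
  fixes X :: "'a topology" and T :: "'a set \<Rightarrow> 'a set"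
    and Y :: "'b topology" and f :: "'a \<Rightarrow> 'b"
  assumes "operator_topological_space X T"
    and "f \<in> topspace X \<rightarrow> topspace Y"
    and "almost_Tstar_continuous X T Y f"
  shows "weakly_almost_contra_Tstar_continuous X T Y f"
  unfolding weakly_almost_contra_Tstar_continuous_def
  using Tstar_closure_eq[OF Tstar_closed_vimage[OF assms(2,3)]] by blast

end
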